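(* Let $n\geq 1$ and let $\phi(x_1,\ldots,x_n)$ be a first-order formula of Presburger arithmetic $FO(\mathbb{Z};<,+)$ with free variables $x_1,\ldots,x_n$. Then there exists a first-order formula $\psi(x_1,\ldots,x_{n-1},y)$ of $FO(\mathbb{Z};<,+)$ (i.e., using no counting quantifiers) such that for all integers $a_1,\ldots,a_{n-1},b$, the formula $\psi(a_1,\ldots,a_{n-1},b)$ holds in $\mathbb{Z}$ if and only if $\exists^{=y}_{x_n}\phi(x_1,\ldots,x_n)$ holds under the interpretation $x_i\mapsto a_i$ ($1\le i\le n-1$), $y\mapsto b$.
   Context: $FO(\mathbb{Z};<,+)$ denotes first-order logic over the structure $\langle \mathbb{Z};<,+\rangle$ (Presburger arithmetic over the integers, without multiplication). A unary counting quantifier is a construct $\exists^{=y}_{x}$ used as a prefix of a formula: the formula $\exists^{=y}_{x_n}\phi(x_1,\ldots,x_n)$ is true under the interpretation $a_1,\ldots,a_{n-1}$ for $x_1,\ldots,x_{n-1}$ and $b$ for $y$ if and only if the number of integers $a$ such that $\phi(a_1,\ldots,a_{n-1},a)$ holds is finite and equals $b$. For example, $\exists^{=y}_{x}(-1\le x\le 3)$ holds if and only if $y=5$. *)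

theory Defs
  imports Main
begin

type_synonym var = nat

datatype tm = Var var | Add tm tm

text \<open>
  The formulas of first-order logic over the signature with \<open><\<close> and \<open>+\<close> (equality is a
  logical symbol), extended by the unary counting quantifier: \<open>CountEx y x \<phi>\<close> stands for
  \<open>\<exists>\<^bsup>=y\<^esup>x. \<phi>\<close>, which binds \<open>x\<close> in \<open>\<phi>\<close> and has \<open>y\<close> as a free variable.
\<close>

datatype fm =
    Eq tm tm
  | Less tm tm
  | Neg fm
  | Conj fm fm
  | Disj fm fm
  | Ex var fm
  | All var fm
  | CountEx var var fm

primrec first_order :: "fm \<Rightarrow> bool" where
  "first_order (Eq s t) = True"
| "first_order (Less s t) = True"
| "first_order (Neg p) = first_order p"
| "first_order (Conj p q) = (first_order p \<and> first_order q)"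
| "first_order (Disj p q) = (first_order p \<and> first_order q)"
| "first_order (Ex x p) = first_order p"
| "first_order (All x p) = first_order p"
| "first_order (CountEx y x p) = False"

primrec vars_tm :: "tm \<Rightarrow> var set" where
  "vars_tm (Var x) = {x}"
| "vars_tm (Add s t) = vars_tm s \<union> vars_tm t"

primrec free_vars :: "fm \<Rightarrow> var set" where
  "free_vars (Eq s t) = vars_tm s \<union> vars_tm t"
| "free_vars (Less s t) = vars_tm s \<union> vars_tm t"
| "free_vars (Neg p) = free_vars p"
| "free_vars (Conj p q) = free_vars p \<union> free_vars q"
| "free_vars (Disj p q) = free_vars p \<union> free_vars q"
| "free_vars (Ex x p) = free_vars p - {x}"
| "free_vars (All x p) = free_vars p - {x}"
| "free_vars (CountEx y x p) = insert y (free_vars p - {x})"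

primrec val :: "(var \<Rightarrow> int) \<Rightarrow> tm \<Rightarrow> int" where
  "val e (Var x) = e x"
| "val e (Add s t) = val e s + val e t"

primrec sat :: "(var \<Rightarrow> int) \<Rightarrow> fm \<Rightarrow> bool" where
  "sat e (Eq s t) = (val e s = val e t)"
| "sat e (Less s t) = (val e s < val e t)"
| "sat e (Neg p) = (\<not> sat e p)"
| "sat e (Conj p q) = (sat e p \<and> sat e q)"
| "sat e (Disj p q) = (sat e p \<or> sat e q)"
| "sat e (Ex x p) = (\<exists>a. sat (e(x := a)) p)"
| "sat e (All x p) = (\<forall>a. sat (e(x := a)) p)"
| "sat e (CountEx y x p) =
    (finite {a. sat (e(x := a)) p} \<and> int (card {a. sat (e(x := a)) p}) = e y)"

lemma val_cong: "(\<And>x. x \<in> vars_tm t \<Longrightarrow> e x = e' x) \<Longrightarrow> val e t = val e' t"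
  by (induction t) auto

text \<open>
  Truth depends only on the values of the free variables, so quantifying over all
  assignments is the same as quantifying over all values of the free variables.
\<close>

lemma sat_cong: "(\<And>x. x \<in> free_vars p \<Longrightarrow> e x = e' x) \<Longrightarrow> sat e p = sat e' p"
proof (induction p arbitrary: e e')
  case (Eq s t)
  then show ?case using val_cong[of s e e'] val_cong[of t e e'] by simp
next
  case (Less s t)
  then show ?case using val_cong[of s e e'] val_cong[of t e e'] by simp
next
  case (Neg p)
  then show ?case by (metis free_vars.simps(3) sat.simps(3))
next
  case (Conj p q)
  then show ?case by (metis UnCI free_vars.simps(4) sat.simps(4))
next
  case (Disj p q)
  then show ?case by (metis UnCI free_vars.simps(5) sat.simps(5))
next
  case (Ex x p)
  have "sat (e(x := a)) p = sat (e'(x := a)) p" for a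
    by (rule Ex.IH) (use Ex.prems in auto)
  then show ?case by simp
next
  case (All x p)
  have "sat (e(x := a)) p = sat (e'(x := a)) p" for a
    by (rule All.IH) (use All.prems in auto)
  then show ?case by simp
next
  case (CountEx y x p)
  have "sat (e(x := a)) p = sat (e'(x := a)) p" for a
    by (rule CountEx.IH) (use CountEx.prems in auto)
  moreover have "e y = e' y" using CountEx.prems by simp
  ultimately show ?case by simp
qed

end

theory Submission
  imports "HOL-Decision_Procs.Cooper" Defs
begin

text \<open>
  By quantifier elimination, membership of \<open>a\<close> in \<open>S e = {a. sat (e(x := a)) \<phi>}\<close> is a Boolean
  combination of inequalities and congruences that are affine in \<open>a\<close>. Hence there are a modulus
  \<open>m\<close> and a bound \<open>k\<close>, both independent of \<open>e\<close>, such that each \<open>{q. m * q + r \<in> S e}\<close> switches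
  between membership and non-membership at most \<open>k\<close> times. If it is bounded, it can be cut at
  most \<open>k\<close> times so that each piece is full or empty. A formula can guess the cuts and add up
  the lengths of the full pieces, and the total count is the sum over the residues \<open>r < m\<close>.
\<close>

section \<open>Definable predicates\<close>

text \<open>Stated for predicates on assignments, so that compound formulas arise from closure
  lemmas. Free variables are not tracked here; \<open>definable_free_vars\<close> recovers them at
  the end.\<close>

definition definable :: "((var \<Rightarrow> int) \<Rightarrow> bool) \<Rightarrow> bool" where
  "definable R \<longleftrightarrow> (\<exists>\<psi>. first_order \<psi> \<and> (\<forall>e. sat e \<psi> = R e))"

definition supported :: "var set \<Rightarrow> ((var \<Rightarrow> int) \<Rightarrow> 'a) \<Rightarrow> bool" where
  "supported V f \<longleftrightarrow> finite V \<and> (\<forall>e e'. (\<forall>v\<in>V. e v = e' v) \<longrightarrow> f e = f e')"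

lemma supported_finite: "supported V f \<Longrightarrow> finite V"
  by (simp add: supported_def)

lemma supported_update: "supported V f \<Longrightarrow> z \<notin> V \<Longrightarrow> f (e(z := a)) = f e"
  unfolding supported_def by (metis fun_upd_other)

lemma supported_comp: "supported V f \<Longrightarrow> supported V (\<lambda>e. g (f e))"
  unfolding supported_def by metis

lemma finite_vars_tm: "finite (vars_tm t)"
  by (induction t) auto

lemma finite_free_vars: "finite (free_vars \<phi>)"
  by (induction \<phi>) (auto simp: finite_vars_tm)

lemma definable_not: "definable R \<Longrightarrow> definable (\<lambda>e. \<not> R e)"
  unfolding definable_def by (metis first_order.simps(3) sat.simps(3))

lemma definable_conj: "definable R \<Longrightarrow> definable Q \<Longrightarrow> definable (\<lambda>e. R e \<and> Q e)"
  unfolding definable_def by (metis first_order.simps(4) sat.simps(4))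

lemma definable_disj: "definable R \<Longrightarrow> definable Q \<Longrightarrow> definable (\<lambda>e. R e \<or> Q e)"
  unfolding definable_def by (metis first_order.simps(5) sat.simps(5))

lemma definable_imp: "definable R \<Longrightarrow> definable Q \<Longrightarrow> definable (\<lambda>e. R e \<longrightarrow> Q e)"
  unfolding imp_conv_disj by (intro definable_disj definable_not)

lemma definable_exists_var: "definable R \<Longrightarrow> definable (\<lambda>e. \<exists>a. R (e(z := a)))"
  unfolding definable_def by (metis first_order.simps(6) sat.simps(6))

lemma definable_eq: "definable (\<lambda>e. e v = e w)"
  unfolding definable_def by (rule exI[of _ "Defs.fm.Eq (Var v) (Var w)"]) simp

lemma definable_eq_add: "definable (\<lambda>e. e u = e v + e w)"
  unfolding definable_def by (rule exI[of _ "Defs.fm.Eq (Var u) (Defs.tm.Add (Var v) (Var w))"]) simp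

lemma definable_less: "definable (\<lambda>e. e v < e w)"
  unfolding definable_def by (rule exI[of _ "Less (Var v) (Var w)"]) simp

lemma definable_le: "definable (\<lambda>e. e v \<le> e w)"
  using definable_not[OF definable_less[of w v]] by (simp add: not_less)

lemma definable_zero: "definable (\<lambda>e. e v = 0)"
  using definable_eq_add[of v v v] by simp

text \<open>The witness is stored in a fresh variable \<open>z\<close> and bound there;
  \<open>fresh\<close> ensures that overwriting \<open>z\<close> does not disturb the other uses of
  the assignment.\<close>

lemma definable_exists:
  assumes V: "finite V"
    and R: "\<And>z. z \<notin> V \<Longrightarrow> definable (\<lambda>e. R e (e z))"
    and fresh: "\<And>e z a b. z \<notin> V \<Longrightarrow> R (e(z := a)) b = R e b"
  shows "definable (\<lambda>e. \<exists>a. R e a)"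
proof -
  obtain z where z: "z \<notin> V"
    using ex_new_if_finite[OF infinite_UNIV_nat V] by blast
  show ?thesis
    using definable_exists_var[OF R[OF z], of z] by (simp add: fresh[OF z])
qed

lemma definable_forall:
  assumes "finite V"
    and "\<And>z. z \<notin> V \<Longrightarrow> definable (\<lambda>e. R e (e z))"
    and "\<And>e z a b. z \<notin> V \<Longrightarrow> R (e(z := a)) b = R e b"
  shows "definable (\<lambda>e. \<forall>a. R e a)"
  using definable_not[OF definable_exists[of V "\<lambda>e a. \<not> R e a"]] assms
  by (simp add: definable_not)

lemmas definable_intros =
  definable_not definable_conj definable_disj definable_imp
  definable_eq definable_eq_add definable_less definable_le definable_zero

text \<open>The signature has no constant 1, but the order is discrete: \<open>e w + 1\<close> is
  the least integer above \<open>e w\<close>.\<close>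

lemma definable_succ: "definable (\<lambda>e. e v = e w + 1)"
proof -
  have "definable (\<lambda>e. e w < e v \<and> (\<forall>a. e w < a \<longrightarrow> e v \<le> a))"
    by (intro definable_intros definable_forall[of "{v, w}"]) auto
  moreover have "(e w < e v \<and> (\<forall>a. e w < a \<longrightarrow> e v \<le> a)) \<longleftrightarrow> e v = e w + 1" for e :: "var \<Rightarrow> int"
    by (auto intro!: antisym)
  ultimately show ?thesis
    by simp
qed

lemma definable_const: "definable (\<lambda>e. e v = int r)"
proof (induction r arbitrary: v)
  case 0
  show ?case
    by (simp add: definable_zero)
next
  case (Suc r)
  have "definable (\<lambda>e. \<exists>a. a = int r \<and> e v = a + 1)"
    by (intro definable_exists[of "{v}"] definable_intros definable_succ Suc) auto
  then show ?case
    by (simp add: add.commute)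
qed

text \<open>\<open>m\<close> and \<open>r\<close> are fixed numbers, not variables of the language,
  so the product unfolds into repeated addition.\<close>

lemma definable_affine: "definable (\<lambda>e. e v = int m * e w + int r)"
proof (induction m arbitrary: v)
  case 0
  show ?case
    by (simp add: definable_const)
next
  case (Suc m)
  have "definable (\<lambda>e. \<exists>a. a = int m * e w + int r \<and> e v = a + e w)"
    by (intro definable_exists[of "{v, w}"] definable_intros Suc) auto
  then show ?case
    by (simp add: algebra_simps)
qed

section \<open>Definable families of integer sets\<close>

definition definable_family :: "var set \<Rightarrow> ((var \<Rightarrow> int) \<Rightarrow> int set) \<Rightarrow> bool" where
  "definable_family V S \<longleftrightarrow> supported V S \<and> (\<forall>v. definable (\<lambda>e. e v \<in> S e))"

lemma definable_family_sat:
  assumes "first_order \<phi>"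
  shows "definable_family (free_vars \<phi>) (\<lambda>e. {a. sat (e(x := a)) \<phi>})"
proof -
  have "definable (\<lambda>e. sat (e(x := e v)) \<phi>)" for v
  proof (cases "v = x")
    case True
    then show ?thesis
      using assms by (auto simp: definable_def)
  next
    case False
    \<comment> \<open>Replacing \<open>x\<close> by \<open>v\<close> is expressed as \<exists>x. v =
      x \<and> \<phi>, which avoids substitution in \<phi>. The binder must not catch
      \<open>v\<close>, hence the case split.\<close>
    have "definable (\<lambda>e. e v = e x \<and> sat e \<phi>)"
      using assms by (intro definable_intros) (auto simp: definable_def)
    from definable_exists_var[OF this, of x] False show ?thesis
      by simp
  qed
  moreover have "supported (free_vars \<phi>) (\<lambda>e. {a. sat (e(x := a)) \<phi>})"
    unfolding supported_def
    by (auto simp: finite_free_vars intro!: Collect_cong sat_cong)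
  ultimately show ?thesis
    by (simp add: definable_family_def)
qed

lemma definable_family_affine:
  assumes S: "definable_family V S"
  shows "definable_family V (\<lambda>e. {q. int m * q + int r \<in> S e})"
proof -
  have sup: "supported V S" and mem: "\<And>v. definable (\<lambda>e. e v \<in> S e)"
    using S by (auto simp: definable_family_def)
  have "definable (\<lambda>e. \<exists>a. a = int m * e v + int r \<and> a \<in> S e)" for v
    using supported_finite[OF sup]
    by (intro definable_exists[of "insert v V"] definable_intros definable_affine mem)
      (auto simp: supported_update[OF sup])
  then show ?thesis
    using supported_comp[OF sup, of "\<lambda>T. {q. int m * q + int r \<in> T}"]
    by (simp add: definable_family_def)
qed

text \<open>A variable outside \<open>V\<close> can be quantified away without changing the meaning,
  as \<open>R\<close> ignores its value. \<open>W\<close> holds the variables still to be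
  removed.\<close>

lemma definable_free_vars:
  assumes R: "definable R" and V: "supported V R"
  shows "\<exists>\<psi>. first_order \<psi> \<and> free_vars \<psi> \<subseteq> V \<and> (\<forall>e. sat e \<psi> = R e)"
proof -
  have "\<exists>\<psi>'. first_order \<psi>' \<and> free_vars \<psi>' \<subseteq> V \<and> (\<forall>e. sat e \<psi>' = R e)"
    if "finite W" "first_order \<psi>" "free_vars \<psi> \<subseteq> V \<union> W" "W \<inter> V = {}" "\<forall>e. sat e \<psi> = R e" for W \<psi>
    using that
  proof (induction W arbitrary: \<psi> rule: finite_induct)
    case empty
    then show ?case by auto
  next
    case (insert w W)
    have "free_vars (fm.Ex w \<psi>) \<subseteq> V \<union> W"
      using insert.prems by auto
    moreover have "\<forall>e. sat e (fm.Ex w \<psi>) = R e"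
      using insert.prems supported_update[OF V, of w] by (metis insert_disjoint(1) sat.simps(6))
    ultimately show ?case
      using insert.IH[of "fm.Ex w \<psi>"] insert.prems by auto
  qed
  moreover obtain \<psi> where "first_order \<psi>" "\<forall>e. sat e \<psi> = R e"
    using R by (auto simp: definable_def)
  ultimately show ?thesis
    using finite_free_vars[of \<psi>] by (metis Diff_disjoint Int_commute Un_Diff_cancel Un_upper2 finite_Diff)
qed

section \<open>Counting sets with few jumps\<close>

definition has_count :: "int set \<Rightarrow> int \<Rightarrow> bool" where
  "has_count S y \<longleftrightarrow> finite S \<and> int (card S) = y"

text \<open>A change of membership is recorded at its left end, so the changes within
  \<open>{l<..u}\<close> are the jumps in \<open>{l<..<u}\<close>.\<close>

definition jumps :: "int set \<Rightarrow> int set" where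
  "jumps S = {t. (t \<in> S) \<noteq> (t + 1 \<in> S)}"

lemma no_jump_constant:
  assumes "jumps S \<inter> {l<..<u} = {}" "a \<in> {l<..u}" "b \<in> {l<..u}" "a \<le> b"
  shows "a \<in> S \<longleftrightarrow> b \<in> S"
  using assms(4,3)
proof (induction b rule: int_ge_induct)
  case base
  show ?case ..
next
  case (step b)
  have "b \<in> {l<..<u}"
    using step assms(2) by auto
  then have "b \<notin> jumps S"
    using assms(1) by blast
  then show ?case
    using step assms(2) by (auto simp: jumps_def)
qed

text \<open>\<open>k\<close> counts cuts, so there are \<open>k + 1\<close> pieces; they may have
  length 0, which makes \<open>k\<close> a mere upper bound. The recursion runs over a fixed number
  and so unfolds to a formula; \<open>u = y + l\<close> avoids subtraction.\<close>

fun piece_count :: "nat \<Rightarrow> int set \<Rightarrow> int \<Rightarrow> int \<Rightarrow> int \<Rightarrow> bool" where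
  "piece_count 0 S l u y \<longleftrightarrow> l \<le> u \<and>
     ((\<forall>a. l < a \<and> a \<le> u \<longrightarrow> a \<in> S) \<and> u = y + l \<or> (\<forall>a. l < a \<and> a \<le> u \<longrightarrow> a \<notin> S) \<and> y = 0)"
| "piece_count (Suc k) S l u y \<longleftrightarrow>
     (\<exists>t y1 y2. piece_count 0 S l t y1 \<and> piece_count k S t u y2 \<and> y = y1 + y2)"

lemma piece_count_0_sound:
  assumes "piece_count 0 S l u y"
  shows "l \<le> u \<and> y = int (card (S \<inter> {l<..u}))"
proof -
  consider "S \<inter> {l<..u} = {l<..u}" "u = y + l" "l \<le> u" | "S \<inter> {l<..u} = {}" "y = 0" "l \<le> u"
    using assms by fastforce
  then show ?thesis
    by cases auto
qed

text \<open>Whichever cuts are guessed, the lengths add up to the true count, so a guess cannot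
  yield a wrong \<open>y\<close>.\<close>

lemma piece_count_sound:
  "piece_count k S l u y \<Longrightarrow> l \<le> u \<and> y = int (card (S \<inter> {l<..u}))"
proof (induction k arbitrary: l y)
  case 0
  then show ?case
    by (rule piece_count_0_sound)
next
  case (Suc k)
  then obtain t y1 y2 where t: "piece_count 0 S l t y1" "piece_count k S t u y2" "y = y1 + y2"
    by auto
  note 1 = piece_count_0_sound[OF t(1)] and 2 = Suc.IH[OF t(2)]
  have "S \<inter> {l<..u} = (S \<inter> {l<..t}) \<union> (S \<inter> {t<..u})"
    using 1 2 by auto
  moreover have "card ((S \<inter> {l<..t}) \<union> (S \<inter> {t<..u})) = card (S \<inter> {l<..t}) + card (S \<inter> {t<..u})"
    by (rule card_Un_disjoint) auto
  ultimately show ?case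
    using 1 2 t(3) by simp
qed

lemma piece_count_0_complete:
  assumes "l \<le> u" "jumps S \<inter> {l<..<u} = {}"
  shows "\<exists>y. piece_count 0 S l u y"
proof (cases "\<exists>a. l < a \<and> a \<le> u \<and> a \<in> S")
  case True
  then obtain a where a: "a \<in> {l<..u}" "a \<in> S"
    by auto
  have "b \<in> S" if "l < b \<and> b \<le> u" for b
    using no_jump_constant[OF assms(2), of a b] no_jump_constant[OF assms(2), of b a] a that
    by (cases "a \<le> b") auto
  then show ?thesis
    using assms(1) by (intro exI[of _ "u - l"]) auto
next
  case False
  then show ?thesis
    using assms(1) by auto
qed

text \<open>Greedy choice: cutting at the least interior jump leaves a constant left piece and one
  jump fewer on the right.\<close>

lemma piece_count_complete:
  assumes "l \<le> u" "card (jumps S \<inter> {l<..<u}) \<le> k"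
  shows "\<exists>y. piece_count k S l u y"
  using assms
proof (induction k arbitrary: l)
  case 0
  then show ?case
    by (intro piece_count_0_complete) auto
next
  case (Suc k)
  let ?J = "\<lambda>l. jumps S \<inter> {l<..<u}"
  show ?case
  proof (cases "?J l = {}")
    case True
    then obtain y where "piece_count k S l u y"
      using Suc by fastforce
    \<comment> \<open>The spare cut is spent on a piece of length 0.\<close>
    moreover have "piece_count 0 S l l 0"
      by auto
    ultimately show ?thesis
      by (metis piece_count.simps(2))
  next
    case False
    define t where "t = Min (?J l)"
    have t: "t \<in> ?J l" "\<And>s. s \<in> ?J l \<Longrightarrow> t \<le> s"
      using False by (auto simp: t_def simp del: Int_iff intro: Min_in)
    then have "?J t = ?J l - {t}"
      by force
    then have "card (?J t) \<le> k"
      using t(1) Suc.prems(2) by (simp del: Int_iff)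
    then obtain y2 where "piece_count k S t u y2"
      using Suc.IH[of t] t(1) by auto
    moreover have "jumps S \<inter> {l<..<t} = {}"
      using t by force
    then obtain y1 where "piece_count 0 S l t y1"
      using piece_count_0_complete[of l t S] t(1) by auto
    ultimately show ?thesis
      by (metis piece_count.simps(2))
  qed
qed

text \<open>A set of integers is finite iff some \<open>{l<..u}\<close> contains it, so guessing the
  bounds expresses finiteness. Completeness then supplies a value and soundness identifies it with
  the cardinality.\<close>

lemma has_count_iff_piece_count:
  assumes "finite (jumps S)" "card (jumps S) \<le> k"
  shows "has_count S y \<longleftrightarrow> (\<exists>l u. (\<forall>a. a \<in> S \<longrightarrow> l < a \<and> a \<le> u) \<and> piece_count k S l u y)"
proof
  assume count: "has_count S y"
  then have "finite (insert 0 S)"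
    by (simp add: has_count_def)
  \<comment> \<open>Inserting 0 makes \<open>Min\<close> and \<open>Max\<close> meaningful for empty
    \<open>S\<close>; the \<open>- 1\<close> is there because the interval excludes
    \<open>l\<close>.\<close>
  define l u where "l = Min (insert 0 S) - 1" and "u = Max (insert 0 S)"
  have "Min (insert 0 S) \<le> a \<and> a \<le> u" if "a \<in> insert 0 S" for a
    using that \<open>finite (insert 0 S)\<close> unfolding u_def by (metis Max_ge Min_le)
  then have lu: "l < a \<and> a \<le> u" if "a \<in> insert 0 S" for a
    using that unfolding l_def by fastforce
  have "card (jumps S \<inter> {l<..<u}) \<le> k"
    using assms card_mono[OF assms(1), of "jumps S \<inter> {l<..<u}"] by auto
  moreover have "l \<le> u"
    using lu[of 0] by simp
  ultimately obtain y' where y': "piece_count k S l u y'"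
    using piece_count_complete by blast
  have "S \<inter> {l<..u} = S"
    using lu by auto
  then have "y' = y"
    using piece_count_sound[OF y'] count by (simp add: has_count_def)
  then show "\<exists>l u. (\<forall>a. a \<in> S \<longrightarrow> l < a \<and> a \<le> u) \<and> piece_count k S l u y"
    using lu y' by blast
next
  assume "\<exists>l u. (\<forall>a. a \<in> S \<longrightarrow> l < a \<and> a \<le> u) \<and> piece_count k S l u y"
  then obtain l u where lu: "\<forall>a. a \<in> S \<longrightarrow> l < a \<and> a \<le> u" and "piece_count k S l u y"
    by blast
  then have "y = int (card (S \<inter> {l<..u}))"
    using piece_count_sound by blast
  moreover have "S \<inter> {l<..u} = S"
    using lu by auto
  moreover from this have "finite S"
    by (metis finite_Int finite_greaterThanAtMost_int)
  ultimately show "has_count S y"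
    by (simp add: has_count_def)
qed

text \<open>Each level of the recursion adds three quantifiers, for the cut and the two partial
  sums. Each new variable has to avoid \<open>V\<close> and those chosen before.\<close>

lemma definable_piece_count:
  assumes S: "definable_family V S"
  shows "definable (\<lambda>e. piece_count k (S e) (e l) (e u) (e y))"
proof (induction k arbitrary: l y)
  have sup: "supported V S" and mem: "\<And>v. definable (\<lambda>e. e v \<in> S e)"
    using S by (auto simp: definable_family_def)
  note fin = supported_finite[OF sup]
  have base: "definable (\<lambda>e. piece_count 0 (S e) (e l) (e u) (e y))" for l u y
    unfolding piece_count.simps
    by (intro definable_intros definable_forall[of "{l, u} \<union> V"] mem)
      (auto simp: fin supported_update[OF sup])
  {
    case 0
    show ?case
      by (rule base)
  next
    case (Suc k)
    show ?case
      unfolding piece_count.simps(2)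
    proof (rule definable_exists[of "{l, u, y} \<union> V"])
      fix t assume t: "t \<notin> {l, u, y} \<union> V"
      show "definable (\<lambda>e. \<exists>y1 y2. piece_count 0 (S e) (e l) (e t) y1 \<and>
              piece_count k (S e) (e t) (e u) y2 \<and> e y = y1 + y2)"
      proof (rule definable_exists[of "{l, u, y, t} \<union> V"])
        fix y1 assume y1: "y1 \<notin> {l, u, y, t} \<union> V"
        show "definable (\<lambda>e. \<exists>y2. piece_count 0 (S e) (e l) (e t) (e y1) \<and>
                piece_count k (S e) (e t) (e u) y2 \<and> e y = e y1 + y2)"
          by (rule definable_exists[of "{l, u, y, t, y1} \<union> V"];
              (intro definable_intros base Suc)?)
            (auto simp: fin supported_update[OF sup] simp del: piece_count.simps)
      qed (auto simp: fin supported_update[OF sup] simp del: piece_count.simps)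
    qed (auto simp: fin supported_update[OF sup] simp del: piece_count.simps)
  }
qed

text \<open>One \<open>k\<close> serves all assignments, because it fixes how many cuts the formula
  guesses.\<close>

lemma definable_has_count_few_jumps:
  assumes S: "definable_family V S"
    and jumps: "\<And>e. finite (jumps (S e)) \<and> card (jumps (S e)) \<le> k"
  shows "definable (\<lambda>e. has_count (S e) (e y))"
proof -
  have sup: "supported V S" and mem: "\<And>v. definable (\<lambda>e. e v \<in> S e)"
    using S by (auto simp: definable_family_def)
  note fin = supported_finite[OF sup]
  have bounds: "definable (\<lambda>e. \<forall>a. a \<in> S e \<longrightarrow> e l < a \<and> a \<le> e u)" for l u
    by (intro definable_intros definable_forall[of "{l, u} \<union> V"] mem)
      (auto simp: fin supported_update[OF sup])
  have "definable (\<lambda>e. \<exists>l u. (\<forall>a. a \<in> S e \<longrightarrow> l < a \<and> a \<le> u) \<and> piece_count k (S e) l u (e y))"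
  proof (rule definable_exists[of "{y} \<union> V"])
    fix l assume l: "l \<notin> {y} \<union> V"
    show "definable (\<lambda>e. \<exists>u. (\<forall>a. a \<in> S e \<longrightarrow> e l < a \<and> a \<le> u) \<and> piece_count k (S e) (e l) u (e y))"
      by (rule definable_exists[of "{y, l} \<union> V"];
          (intro definable_conj bounds definable_piece_count[OF S])?)
        (auto simp: fin supported_update[OF sup])
  qed (auto simp: fin supported_update[OF sup])
  then show ?thesis
    using has_count_iff_piece_count[OF jumps[THEN conjunct1] jumps[THEN conjunct2]] by simp
qed

section \<open>Splitting into residue classes\<close>

lemma has_count_Un_disjoint:
  assumes "S \<inter> S' = {}"
  shows "has_count (S \<union> S') y \<longleftrightarrow> (\<exists>y1 y2. has_count S y1 \<and> has_count S' y2 \<and> y = y1 + y2)"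
  using card_Un_disjoint[OF _ _ assms] by (auto simp: has_count_def)

text \<open>Division by \<open>m\<close> inverts q \<mapsto> m * q + r on the residue class, so the
  two sets are in bijection.\<close>

lemma has_count_residue_class:
  assumes "r < m"
  shows "has_count {a \<in> S. a mod int m = int r} y \<longleftrightarrow> has_count {q. int m * q + int r \<in> S} y"
proof -
  let ?f = "\<lambda>q. int m * q + int r"
  have inj: "inj_on ?f X" for X
    using assms by (auto simp: inj_on_def)
  have "a \<in> ?f ` {q. ?f q \<in> S}" if "a \<in> S" "a mod int m = int r" for a
    using that by (intro image_eqI[of _ _ "a div int m"]) (metis mult_div_mod_eq, simp, metis mult_div_mod_eq)
  then have "{a \<in> S. a mod int m = int r} = ?f ` {q. ?f q \<in> S}"
    using assms by auto
  then show ?thesis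
    by (simp add: has_count_def card_image[OF inj] finite_image_iff[OF inj])
qed

lemma definable_has_count:
  assumes S: "definable_family V S" and m: "m > 0"
    and jumps: "\<And>e r. finite (jumps {q. int m * q + int r \<in> S e}) \<and>
                  card (jumps {q. int m * q + int r \<in> S e}) \<le> k"
  shows "definable (\<lambda>e. has_count (S e) (e y))"
proof -
  have sup: "supported V S"
    using S by (auto simp: definable_family_def)
  have "definable (\<lambda>e. has_count {a \<in> S e. a mod int m < int j} (e y))" if "j \<le> m" for j y
    using that
  proof (induction j arbitrary: y)
    case 0
    have "{a \<in> S e. a mod int m < int 0} = {}" for e
      using m by (auto simp: not_less)
    then have "has_count {a \<in> S e. a mod int m < int 0} z \<longleftrightarrow> z = 0" for e z
      by (auto simp only: has_count_def card.empty finite.emptyI)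
    then show ?case
      by (simp only: definable_zero)
  next
    case (Suc j)
    let ?A = "\<lambda>e. {a \<in> S e. a mod int m < int j}"
    let ?B = "\<lambda>e. {a \<in> S e. a mod int m = int j}"
    have A: "definable (\<lambda>e. has_count (?A e) (e v))" for v
      using Suc by simp
    \<comment> \<open>Class \<open>j\<close> inside the integers can have arbitrarily many jumps;
      the bound applies once it is rescaled to the quotients \<open>q\<close>.\<close>
    have B: "definable (\<lambda>e. has_count (?B e) (e v))" for v
      using definable_has_count_few_jumps[OF definable_family_affine[OF S] jumps]
        has_count_residue_class[of j m] Suc.prems by simp
    have AB: "{a \<in> S e. a mod int m < int (Suc j)} = ?A e \<union> ?B e" "?A e \<inter> ?B e = {}" for e
      by auto
    have "definable (\<lambda>e. \<exists>y1 y2. has_count (?A e) y1 \<and> has_count (?B e) y2 \<and> e y = y1 + y2)"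
    proof (rule definable_exists[of "{y} \<union> V"])
      fix y1 assume y1: "y1 \<notin> {y} \<union> V"
      show "definable (\<lambda>e. \<exists>y2. has_count (?A e) (e y1) \<and> has_count (?B e) y2 \<and> e y = e y1 + y2)"
        by (rule definable_exists[of "{y, y1} \<union> V"]; (intro definable_intros A B)?)
          (auto simp: supported_finite[OF sup] supported_update[OF sup])
    qed (auto simp: supported_finite[OF sup] supported_update[OF sup])
    then show ?case
      unfolding AB(1) has_count_Un_disjoint[OF AB(2)] .
  qed
  \<comment> \<open>Every remainder is below \<open>m\<close>, so for \<open>j = m\<close> the set
    is all of \<open>S e\<close>.\<close>
  from this[of m y] show ?thesis
    using m by simp
qed

section \<open>Uniform bounds on jumps from quantifier elimination\<close>

text \<open>The list \<open>bs\<close> assigns values to the remaining variables, as in the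
  environment \<open>x # bs\<close> of Cooper's formulas.\<close>

definition jumps_le :: "nat \<Rightarrow> nat \<Rightarrow> (int list \<Rightarrow> int \<Rightarrow> bool) \<Rightarrow> bool" where
  "jumps_le m k P \<longleftrightarrow> (\<forall>bs r. finite (jumps {q. P bs (int m * q + r)}) \<and>
     card (jumps {q. P bs (int m * q + r)}) \<le> k)"

text \<open>The modulus is required to work together with all its multiples, so that moduli of
  subformulas can be combined by taking products.\<close>

definition few_jumps :: "(int list \<Rightarrow> int \<Rightarrow> bool) \<Rightarrow> bool" where
  "few_jumps P \<longleftrightarrow> (\<exists>M k. M > 0 \<and> (\<forall>m. M dvd m \<longrightarrow> jumps_le m k P))"

lemma few_jumps_const: "few_jumps (\<lambda>bs x. P bs)"
  unfolding few_jumps_def jumps_le_def jumps_def by (rule exI[of _ 1]) simp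

text \<open>Where neither \<open>P\<close> nor \<open>Q\<close> changes, no function of the two
  truth values can change, so the jumps lie in the union.\<close>

lemma jumps_le_binary:
  assumes "jumps_le m k P" "jumps_le m l Q"
  shows "jumps_le m (k + l) (\<lambda>bs x. f (P bs x) (Q bs x))"
  unfolding jumps_le_def
proof (intro allI)
  fix bs r
  let ?P = "jumps {q. P bs (int m * q + r)}" and ?Q = "jumps {q. Q bs (int m * q + r)}"
  have P: "finite ?P" "card ?P \<le> k" and Q: "finite ?Q" "card ?Q \<le> l"
    using assms by (simp_all add: jumps_le_def)
  have sub: "jumps {q. f (P bs (int m * q + r)) (Q bs (int m * q + r))} \<subseteq> ?P \<union> ?Q" (is "?J \<subseteq> _")
  proof (rule subsetI, rule ccontr)
    fix t assume "t \<in> ?J" "t \<notin> ?P \<union> ?Q"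
    from this(2) have "P bs (int m * t + r) = P bs (int m * (t + 1) + r)"
      "Q bs (int m * t + r) = Q bs (int m * (t + 1) + r)"
      by (auto simp: jumps_def)
    with \<open>t \<in> ?J\<close> show False
      by (simp add: jumps_def)
  qed
  have "card (?P \<union> ?Q) \<le> k + l"
    using card_Un_le[of ?P ?Q] P Q by linarith
  then show "finite ?J \<and> card ?J \<le> k + l"
    using card_mono[OF _ sub] finite_subset[OF sub] P Q by auto
qed

lemma few_jumps_binary:
  assumes "few_jumps P" "few_jumps Q"
  shows "few_jumps (\<lambda>bs x. f (P bs x) (Q bs x))"
proof -
  obtain M k where M: "M > 0" "\<forall>m. M dvd m \<longrightarrow> jumps_le m k P"
    using assms(1) unfolding few_jumps_def by (elim exE conjE)
  obtain N l where N: "N > 0" "\<forall>m. N dvd m \<longrightarrow> jumps_le m l Q"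
    using assms(2) unfolding few_jumps_def by (elim exE conjE)
  have "jumps_le m (k + l) (\<lambda>bs x. f (P bs x) (Q bs x))" if "M * N dvd m" for m
    using M(2) N(2) dvd_mult_left[OF that] dvd_mult_right[OF that] by (intro jumps_le_binary) simp_all
  with M(1) N(1) show ?thesis
    unfolding few_jumps_def by (intro exI[of _ "M * N"] exI[of _ "k + l"]) simp
qed

lemma few_jumps_not: "few_jumps P \<Longrightarrow> few_jumps (\<lambda>bs x. \<not> P bs x)"
  using few_jumps_binary[of P P "\<lambda>p _. \<not> p"] by simp

section \<open>Jumps of affine atoms\<close>

text \<open>An affine function of \<open>q\<close> is monotone, so its sign condition changes at
  most once, for every modulus.\<close>

lemma few_jumps_less: "few_jumps (\<lambda>bs x. c * x + s bs < 0)"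
proof -
  have "finite (jumps {q. c * (int m * q + r) + s bs < 0}) \<and>
      card (jumps {q. c * (int m * q + r) + s bs < 0}) \<le> 1" for m bs r
  proof -
    let ?J = "jumps {q. c * (int m * q + r) + s bs < 0}"
    define d where "d = c * int m"
    have J: "?J = {q. (d * q + (c * r + s bs) < 0) \<noteq> (d * (q + 1) + (c * r + s bs) < 0)}"
      by (simp add: jumps_def d_def algebra_simps)
    have "\<not> p < q" if "p \<in> ?J" "q \<in> ?J" for p q
    proof
      assume "p < q"
      \<comment> \<open>The factor \<open>\<bar>d\<bar>\<close> serves both signs of
        \<open>d\<close>: from \<open>p + 1\<close> to \<open>q\<close> the value moves on in the
        direction of the first change, whereas a second change at \<open>q\<close> would need it to
        come back.\<close>
      then have "\<bar>d\<bar> * (p + 1) \<le> \<bar>d\<bar> * q"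
        by (intro mult_left_mono) auto
      with that show False
        unfolding J by (cases "d \<ge> 0") (auto simp: algebra_simps)
    qed
    then have "p = q" if "p \<in> ?J" "q \<in> ?J" for p q
      using that by (meson linorder_neqE)
    then obtain p where "?J \<subseteq> {p}"
      by blast
    then show ?thesis
      using card_mono[of "{p}" ?J] finite_subset[of ?J "{p}"] by simp
  qed
  then show ?thesis
    unfolding few_jumps_def jumps_le_def by (intro exI[of _ 1]) auto
qed

text \<open>Over the integers, t = 0 says that t < 0 fails and t - 1 < 0 holds.\<close>

lemma few_jumps_eq: "few_jumps (\<lambda>bs x. c * x + s bs = 0)"
proof -
  have "(\<lambda>bs x. c * x + s bs = 0) = (\<lambda>bs x. \<not> c * x + s bs < 0 \<and> c * x + (s bs - 1) < 0)"
    by (intro ext) linarith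
  then show ?thesis
    using few_jumps_binary[OF few_jumps_less few_jumps_less, of "\<lambda>p q. \<not> p \<and> q" c s c "\<lambda>bs. s bs - 1"]
    by simp
qed

text \<open>For nonzero \<open>d\<close>, steps by a multiple of \<open>d\<close> keep the residue
  modulo \<open>d\<close>, so there are no jumps at all. These atoms are the reason for passing to
  residue classes. Divisibility by 0 is an equation.\<close>

lemma few_jumps_dvd: "few_jumps (\<lambda>bs x. d dvd c * x + s bs)"
proof (cases "d = 0")
  case True
  then show ?thesis
    by (simp add: few_jumps_eq)
next
  case False
  have "jumps {q. d dvd c * (int m * q + r) + s bs} = {}" if "nat \<bar>d\<bar> dvd m" for m bs r
  proof -
    have "d dvd int m"
      using that int_dvd_int_iff[of "nat \<bar>d\<bar>" m] by simp
    then have "d dvd c * (int m * (q + 1) + r) + s bs \<longleftrightarrow> d dvd c * (int m * q + r) + s bs" for q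
      using dvd_add_right_iff[of d "c * int m" "c * (int m * q + r) + s bs"]
      by (simp add: algebra_simps)
    then show ?thesis
      by (simp add: jumps_def)
  qed
  then show ?thesis
    unfolding few_jumps_def jumps_le_def using False by (intro exI[of _ "nat \<bar>d\<bar>"]) auto
qed

lemma Inum_affine: "\<exists>c s. \<forall>bs x. Inum (x # bs) t = c * x + s bs"
proof (induction t)
  case (C c)
  show ?case by (intro exI[of _ 0] exI[of _ "\<lambda>bs. c"]) simp
next
  case (Bound n)
  show ?case
    by (intro exI[of _ "if n = 0 then 1 else 0"] exI[of _ "\<lambda>bs. if n = 0 then 0 else bs ! (n - 1)"])
      (simp add: nth_Cons')
next
  case (CN n d t)
  then obtain c s where "\<forall>bs x. Inum (x # bs) t = c * x + s bs"
    by (elim exE)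
  then show ?case
    by (intro exI[of _ "(if n = 0 then d else 0) + c"]
          exI[of _ "\<lambda>bs. (if n = 0 then 0 else d * bs ! (n - 1)) + s bs"])
      (simp add: nth_Cons' algebra_simps)
next
  case (Neg t)
  then obtain c s where "\<forall>bs x. Inum (x # bs) t = c * x + s bs"
    by (elim exE)
  then show ?case
    by (intro exI[of _ "- c"] exI[of _ "\<lambda>bs. - s bs"]) simp
next
  case (Add t u)
  then obtain c s d s' where "\<forall>bs x. Inum (x # bs) t = c * x + s bs"
    "\<forall>bs x. Inum (x # bs) u = d * x + s' bs"
    by (elim exE)
  then show ?case
    by (intro exI[of _ "c + d"] exI[of _ "\<lambda>bs. s bs + s' bs"]) (simp add: algebra_simps)
next
  case (Sub t u)
  then obtain c s d s' where "\<forall>bs x. Inum (x # bs) t = c * x + s bs"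
    "\<forall>bs x. Inum (x # bs) u = d * x + s' bs"
    by (elim exE)
  then show ?case
    by (intro exI[of _ "c - d"] exI[of _ "\<lambda>bs. s bs - s' bs"]) (simp add: algebra_simps)
next
  case (Mul d t)
  then obtain c s where "\<forall>bs x. Inum (x # bs) t = c * x + s bs"
    by (elim exE)
  then show ?case
    by (intro exI[of _ "d * c"] exI[of _ "\<lambda>bs. d * s bs"]) (simp add: algebra_simps)
qed

lemma few_jumps_atoms:
  shows "few_jumps (\<lambda>bs x. Inum (x # bs) t < 0)"
    and "few_jumps (\<lambda>bs x. Inum (x # bs) t = 0)"
    and "few_jumps (\<lambda>bs x. Inum (x # bs) t \<le> 0)"
    and "few_jumps (\<lambda>bs x. d dvd Inum (x # bs) t)"
proof -
  obtain c s where c: "\<forall>bs x. Inum (x # bs) t = c * x + s bs"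
    using Inum_affine[of t] by (elim exE)
  show less: "few_jumps (\<lambda>bs x. Inum (x # bs) t < 0)"
    and eq: "few_jumps (\<lambda>bs x. Inum (x # bs) t = 0)"
    and "few_jumps (\<lambda>bs x. d dvd Inum (x # bs) t)"
    by (simp_all add: c few_jumps_less few_jumps_eq few_jumps_dvd)
  show "few_jumps (\<lambda>bs x. Inum (x # bs) t \<le> 0)"
    using few_jumps_binary[OF less eq, of "(\<or>)"] by (simp add: le_less)
qed

text \<open>Propositional atoms of Cooper's syntax depend on \<open>bbs\<close> alone and are
  constant in \<open>x\<close>; the arithmetic atoms are affine.\<close>

lemma few_jumps_qfree: "qfree p \<Longrightarrow> few_jumps (\<lambda>bs x. Ifm bbs (x # bs) p)"
proof (induction p)
  case (Gt t)
  show ?case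
    using few_jumps_not[OF few_jumps_atoms(3)[of t]] by (simp add: not_le)
next
  case (Ge t)
  show ?case
    using few_jumps_not[OF few_jumps_atoms(1)[of t]] by (simp add: not_less)
next
  case (And p q)
  then show ?case
    using few_jumps_binary[where f = "(\<and>)"] by simp
next
  case (Or p q)
  then show ?case
    using few_jumps_binary[where f = "(\<or>)"] by simp
next
  case (Imp p q)
  then show ?case
    using few_jumps_binary[where f = "(\<longrightarrow>)"] by simp
next
  case (Iff p q)
  then show ?case
    using few_jumps_binary[where f = "(=)"] by simp
qed (simp_all add: few_jumps_const few_jumps_atoms few_jumps_not)

section \<open>Translation of named variables into de Bruijn syntax\<close>

primrec num_of :: "(var \<Rightarrow> nat) \<Rightarrow> tm \<Rightarrow> Cooper.num" where
  "num_of \<rho> (Var v) = Bound (\<rho> v)"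
| "num_of \<rho> (Defs.tm.Add s t) = Cooper.num.Add (num_of \<rho> s) (num_of \<rho> t)"

text \<open>Named variables become de Bruijn indices: \<open>\<rho> v\<close> is the index of \<open>v\<close>.
  The value on counting quantifiers is irrelevant.\<close>

primrec fm_of :: "(var \<Rightarrow> nat) \<Rightarrow> Defs.fm \<Rightarrow> Cooper.fm" where
  "fm_of \<rho> (Defs.fm.Eq s t) = Cooper.fm.Eq (Sub (num_of \<rho> s) (num_of \<rho> t))"
| "fm_of \<rho> (Less s t) = Lt (Sub (num_of \<rho> s) (num_of \<rho> t))"
| "fm_of \<rho> (Defs.fm.Neg p) = Not (fm_of \<rho> p)"
| "fm_of \<rho> (Conj p q) = And (fm_of \<rho> p) (fm_of \<rho> q)"
| "fm_of \<rho> (Disj p q) = Or (fm_of \<rho> p) (fm_of \<rho> q)"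
| "fm_of \<rho> (fm.Ex x p) = E (fm_of ((Suc \<circ> \<rho>)(x := 0)) p)"
| "fm_of \<rho> (fm.All x p) = A (fm_of ((Suc \<circ> \<rho>)(x := 0)) p)"
| "fm_of \<rho> (CountEx y x p) = F"

lemma Inum_num_of: "Inum bs (num_of \<rho> t) = val (\<lambda>v. bs ! \<rho> v) t"
  by (induction t) auto

text \<open>A quantifier puts its value at the head of the list;
  \<open>(Suc \<circ> \<rho>)(x := 0)\<close> shifts the other names past it and redirects
  \<open>x\<close>, even if \<open>x\<close> already had an index outside.\<close>

lemma Ifm_fm_of: "first_order \<phi> \<Longrightarrow> Ifm bbs bs (fm_of \<rho> \<phi>) = sat (\<lambda>v. bs ! \<rho> v) \<phi>"
proof (induction \<phi> arbitrary: bs \<rho>)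
  case (Ex x p)
  have "(\<lambda>v. (a # bs) ! ((Suc \<circ> \<rho>)(x := 0)) v) = (\<lambda>v. bs ! \<rho> v)(x := a)" for a
    by auto
  with Ex show ?case by simp
next
  case (All x p)
  have "(\<lambda>v. (a # bs) ! ((Suc \<circ> \<rho>)(x := 0)) v) = (\<lambda>v. bs ! \<rho> v)(x := a)" for a
    by auto
  with All show ?case by simp
qed (auto simp: Inum_num_of)

text \<open>\<open>pa\<close> is Cooper's quantifier elimination and \<open>mirqe\<close> its
  correctness. Only the modulus and the bound are taken from the eliminated formula; what is counted
  is still defined by \<open>\<phi>\<close>.\<close>

lemma sat_jumps_bounded:
  assumes "first_order \<phi>"
  obtains m k where "m > 0"
    "\<And>e r. finite (jumps {q. sat (e(x := int m * q + r)) \<phi>}) \<and>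
       card (jumps {q. sat (e(x := int m * q + r)) \<phi>}) \<le> k"
proof -
  define p where "p = fm_of (Suc(x := 0)) \<phi>"
  have "few_jumps (\<lambda>bs a. Ifm [] (a # bs) (pa p))"
    using few_jumps_qfree mirqe by blast
  then obtain m k where m: "m > 0" and k: "\<forall>m'. m dvd m' \<longrightarrow> jumps_le m' k (\<lambda>bs a. Ifm [] (a # bs) (pa p))"
    unfolding few_jumps_def by (elim exE conjE)
  obtain N where N: "\<forall>v \<in> free_vars \<phi>. v < N"
    using finite_free_vars finite_nat_set_iff_bounded by metis
  \<comment> \<open>Index 0 stands for \<open>x\<close> and \<open>Suc v\<close> for any other
    \<open>v\<close>; \<open>N\<close> exceeds all free variables, so the list is long enough for
    every lookup that matters.\<close>
  have sat: "sat (e(x := a)) \<phi> = Ifm [] (a # map e [0..<N]) (pa p)" for e a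
  proof -
    have "Ifm [] (a # map e [0..<N]) (pa p) = Ifm [] (a # map e [0..<N]) p"
      using mirqe by blast
    also have "\<dots> = sat (\<lambda>v. (a # map e [0..<N]) ! (Suc(x := 0)) v) \<phi>"
      unfolding p_def by (rule Ifm_fm_of[OF assms])
    also have "\<dots> = sat (e(x := a)) \<phi>"
      by (rule sat_cong) (use N in auto)
    finally show ?thesis ..
  qed
  show thesis
    by (rule that[OF m, of k]) (use k[rule_format, OF dvd_refl] in \<open>simp add: sat jumps_le_def\<close>)
qed

theorem theorem1:
  fixes n :: nat and x :: "nat \<Rightarrow> var" and y :: var and \<phi> :: fm
  assumes "n \<ge> 1"
    and "inj_on x {1..n}"
    and "y \<notin> x ` {1..n}"
    and "first_order \<phi>"
    and "free_vars \<phi> \<subseteq> x ` {1..n}"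
  shows "\<exists>\<psi>. first_order \<psi> \<and> free_vars \<psi> \<subseteq> x ` {1..n-1} \<union> {y} \<and>
           (\<forall>e :: var \<Rightarrow> int. sat e \<psi> \<longleftrightarrow> sat e (CountEx y (x n) \<phi>))"
proof -
  let ?S = "\<lambda>e. {a. sat (e(x n := a)) \<phi>}"
  obtain m k where m: "m > 0"
    and k: "\<And>e r. finite (jumps {q. sat (e(x n := int m * q + r)) \<phi>}) \<and>
       card (jumps {q. sat (e(x n := int m * q + r)) \<phi>}) \<le> k"
    using sat_jumps_bounded[OF assms(4)] by blast
  have "definable (\<lambda>e. has_count (?S e) (e y))"
    using definable_has_count[OF definable_family_sat[OF assms(4)] m, of "x n" k] k by simp
  then have "definable (\<lambda>e. sat e (CountEx y (x n) \<phi>))"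
    by (simp add: has_count_def)
  moreover have "{1..n} = insert n {1..n-1}"
    using assms(1) by auto
  then have "free_vars (CountEx y (x n) \<phi>) \<subseteq> x ` {1..n-1} \<union> {y}"
    using assms(5) by auto
  \<comment> \<open>\<open>sat_cong\<close> also covers counting quantifiers, so the free variables
    of the counting formula bound what its truth depends on, and the first-order equivalent can be
    confined to the same variables.\<close>
  then have "supported (x ` {1..n-1} \<union> {y}) (\<lambda>e. sat e (CountEx y (x n) \<phi>))"
    unfolding supported_def by (intro conjI allI impI sat_cong) auto
  ultimately show ?thesis
    by (rule definable_free_vars)
qed

end
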